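(* Let $0<a<1$ and $0\le b<1$. The dynamical system $f_\pm$ has at most one periodic orbit (periodic orbits being identified with their sets of points, i.e., disregarding the choice of initial point and repetitions).
   Context: For real $x$ let $\{x\}:=x-\lfloor x\rfloor\in[0,1)$ and $\{x\}_+:=1-\{-x\}\in(0,1]$. For constants $0<a<1$, $0\le b<1$ define $f_-,f_+:[0,1]\to[0,1]$ by $f_-(x)=\{ax+b\}$, $f_+(x)=\{ax+b\}_+$, and let $f_\pm$ be the multi-valued map $x\mapsto\{f_-(x),f_+(x)\}$ (a single value unless $ax+b$ is an integer, in which case the two values are $0$ and $1$). An orbit of $f_\pm$ is any sequence $(x_n)_{n\ge0}$ in $[0,1]$ with $x_{n+1}\in f_\pm(x_n)$ for all $n\ge0$. A periodic orbit is an orbit with $x_{n+q}=x_n$ for some $q\ge1$ and all $n\ge0$; it is then written $\{x_0,\dots,x_{q-1}\}$. *)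

theory Defs
  imports Complex_Main
begin

definition frac_plus :: "real \<Rightarrow> real" where
  "frac_plus x = 1 - frac (- x)"

text \<open>The maps below are total on the reals; only their restrictions to \<open>{0..1}\<close> matter,
  since orbits are required to stay in that interval.\<close>

definition f_minus :: "real \<Rightarrow> real \<Rightarrow> real \<Rightarrow> real" where
  "f_minus a b x = frac (a * x + b)"

definition f_plus :: "real \<Rightarrow> real \<Rightarrow> real \<Rightarrow> real" where
  "f_plus a b x = frac_plus (a * x + b)"

definition f_pm :: "real \<Rightarrow> real \<Rightarrow> real \<Rightarrow> real set" where
  "f_pm a b x = {f_minus a b x, f_plus a b x}"

definition orbit :: "real \<Rightarrow> real \<Rightarrow> (nat \<Rightarrow> real) \<Rightarrow> bool" where
  "orbit a b x \<longleftrightarrow> (\<forall>n. x n \<in> {0..1}) \<and> (\<forall>n. x (Suc n) \<in> f_pm a b (x n))"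

text \<open>The set of points \<open>{x 0, \<dots>, x (q - 1)}\<close> of a periodic orbit \<open>x\<close> is \<open>range x\<close>.\<close>

definition periodic_orbit :: "real \<Rightarrow> real \<Rightarrow> (nat \<Rightarrow> real) \<Rightarrow> bool" where
  "periodic_orbit a b x \<longleftrightarrow> orbit a b x \<and> (\<exists>q\<ge>1. \<forall>n. x (n + q) = x n)"

end

theory Submission
  imports Defs
begin

text \<open>Although \<open>f_pm\<close> is multi-valued, it is injective modulo 1: the slope is less than 1, so
  points of \<open>[0,1]\<close> whose images differ by an integer coincide. Running backwards along periodic
  orbits, two points differing by an integer must be equal and their orbits have the same range.
  If the ranges differ, choose a pair minimising the circular distance \<open>frac (x n - y m)\<close>, which
  lies in \<open>(0,1)\<close>. If \<open>x n > y m\<close>, one step of the dynamics multiplies this distance by \<open>a\<close>,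
  so the minimum is attained only across the wrap from 1 to 0. This holds for both directions, from
  \<open>y\<close> up to \<open>x\<close> and from \<open>x\<close> up to \<open>y\<close>, and comparing the two minimal pairs produces an orbit
  that contains both 0 and 1, which is impossible.\<close>

text \<open>Both branches agree modulo 1 with the same affine map, so working up to integers removes
  the choice of branch.\<close>

lemma f_pm_step:
  assumes "z \<in> f_pm a b w"
  obtains d :: int where "z = a * w + b - of_int d"
proof -
  have "\<exists>d::int. z = a * w + b - of_int d"
  proof (cases "z = f_minus a b w")
    case True
    then show ?thesis unfolding f_minus_def frac_def by blast
  next
    case False
    then have "z = a * w + b - of_int (- 1 - \<lfloor>- (a * w + b)\<rfloor>)"
      using assms by (simp add: f_pm_def f_plus_def frac_plus_def frac_def)
    then show ?thesis by blast
  qed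
  then show thesis using that by blast
qed

lemma f_pm_step_diff:
  assumes "orbit a b x" "orbit a b y"
  obtains d :: int where "x (Suc n) - y (Suc m) = a * (x n - y m) + of_int d"
proof -
  obtain d where d: "x (Suc n) = a * x n + b - of_int d"
    using assms(1) f_pm_step unfolding orbit_def by metis
  obtain e where e: "y (Suc m) = a * y m + b - of_int e"
    using assms(2) f_pm_step unfolding orbit_def by metis
  show thesis by (rule that[of "e - d"]) (simp add: d e algebra_simps)
qed

lemma orbit_backward_unique:
  assumes "0 < a" "a < 1" "orbit a b x" "orbit a b y"
    and "x (Suc n) - y (Suc m) \<in> \<int>"
  shows "x n = y m"
proof -
  obtain d :: int where "x (Suc n) - y (Suc m) = a * (x n - y m) + of_int d"
    using f_pm_step_diff assms by metis
  then have "a * (x n - y m) \<in> \<int>"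
    using assms(5) by (metis Ints_diff Ints_of_int add_diff_cancel_right')
  then obtain k :: int where k: "a * (x n - y m) = of_int k" by (auto elim: Ints_cases)
  have "\<bar>x n - y m\<bar> \<le> 1"
    using assms(3,4) unfolding orbit_def by (smt (verit) atLeastAtMost_iff)
  then have "\<bar>a * (x n - y m)\<bar> < 1"
    using assms(1,2) mult_left_mono[of "\<bar>x n - y m\<bar>" 1 a] unfolding abs_mult by linarith
  then have "k = 0" using k by linarith
  then show ?thesis using k assms(1) by simp
qed

text \<open>The strict \<open>j < k\<close> matters: at offset \<open>k\<close> the points may still
  be 0 and 1, and one backward step turns congruence into equality.\<close>

lemma orbit_backward_eq:
  assumes "0 < a" "a < 1" "orbit a b x" "orbit a b y"
    and "x (n + k) - y (m + k) \<in> \<int>" and "j < k"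
  shows "x (n + j) = y (m + j)"
  using assms(5,6)
proof (induction k)
  case (Suc k)
  then have "x (n + k) = y (m + k)"
    using orbit_backward_unique[OF assms(1-4), of "n + k" "m + k"] by simp
  then show ?case using Suc by (cases "j = k") auto
qed simp

lemma periodic_mult:
  fixes x :: "nat \<Rightarrow> 'a"
  assumes "\<forall>n. x (n + q) = x n"
  shows "x (n + k * q) = x n"
proof (induction k)
  case (Suc k)
  then show ?case using assms by (metis add.assoc add.commute mult_Suc)
qed simp

lemma periodic_finite_range:
  fixes x :: "nat \<Rightarrow> 'a"
  assumes "q \<ge> 1" "\<forall>n. x (n + q) = x n"
  shows "finite (range x)"
proof -
  have "x n = x (n mod q)" for n
    using periodic_mult[OF assms(2), of "n mod q" "n div q"] by (simp add: mult.commute)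
  then have "range x \<subseteq> x ` {..<q}" using assms(1)
    by (metis (no_types, lifting) image_iff image_subset_iff lessThan_iff mod_less_divisor less_eq_Suc_le One_nat_def)
  then show ?thesis by (meson finite_imageI finite_lessThan finite_subset)
qed

lemma common_period:
  assumes "periodic_orbit a b x" "periodic_orbit a b y"
  obtains q where "q \<ge> 1" "\<forall>n. x (n + q) = x n" "\<forall>n. y (n + q) = y n"
proof -
  obtain p q where "p \<ge> 1" "\<forall>n. x (n + p) = x n" "q \<ge> 1" "\<forall>n. y (n + q) = y n"
    using assms unfolding periodic_orbit_def by blast
  moreover from this have "x (n + p * q) = x n" "y (n + p * q) = y n" for n
    using periodic_mult[of x p n q] periodic_mult[of y q n p] by (simp_all add: mult.commute)
  ultimately show thesis using that[of "p * q"] by simp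
qed

text \<open>Periodicity carries the congruence to a later time, from which the backward lemma
  reaches every intermediate offset.\<close>

lemma periodic_orbit_forward_eq:
  assumes "0 < a" "a < 1" "periodic_orbit a b x" "periodic_orbit a b y"
    and "x n - y m \<in> \<int>"
  shows "x (n + j) = y (m + j)"
proof -
  obtain q where q: "q \<ge> 1" "\<forall>n. x (n + q) = x n" "\<forall>n. y (n + q) = y n"
    using common_period assms(3,4) .
  have "x (n + Suc j * q) - y (m + Suc j * q) \<in> \<int>"
    using assms(5) periodic_mult[OF q(2)] periodic_mult[OF q(3)] by metis
  \<comment> \<open>With only \<open>j\<close> periods the inequality would fail to be strict for
    \<open>j = 0\<close> or \<open>q = 1\<close>.\<close>
  moreover have "j < Suc j * q"
    using q(1) by (metis Suc_le_eq mult_le_mono2 mult.right_neutral)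
  ultimately show ?thesis
    using orbit_backward_eq assms(1-4) unfolding periodic_orbit_def by blast
qed

lemma periodic_orbit_range_subset:
  assumes "0 < a" "a < 1" "periodic_orbit a b x" "periodic_orbit a b y"
    and "x n - y m \<in> \<int>"
  shows "range x \<subseteq> range y"
proof
  fix z assume "z \<in> range x"
  then obtain i where i: "z = x i" by blast
  obtain q where q: "q \<ge> 1" "\<forall>n. x (n + q) = x n"
    using assms(3) unfolding periodic_orbit_def by blast
  \<comment> \<open>Adding \<open>n\<close> periods moves the index \<open>i\<close> past
    \<open>n\<close> without changing the point.\<close>
  have "n \<le> i + n * q" using q(1) by (simp add: trans_le_add2)
  then obtain j where "i + n * q = n + j" using le_Suc_ex by blast
  then have "z = y (m + j)"
    using i periodic_mult[OF q(2), of i n] periodic_orbit_forward_eq[OF assms] by metis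
  then show "z \<in> range y" by blast
qed

lemma minimal_circular_gap_wraps:
  assumes "0 < a" "a < 1" "periodic_orbit a b x" "periodic_orbit a b y"
    and disj: "\<And>n m. x n - y m \<notin> \<int>"
  obtains n m where "x n < y m" "\<And>i j. y j < x i \<Longrightarrow> 1 + x n - y m \<le> x i - y j"
proof -
  have ox: "orbit a b x" and oy: "orbit a b y"
    using assms(3,4) unfolding periodic_orbit_def by auto
  have bnd: "x i \<in> {0..1}" "y i \<in> {0..1}" for i
    using ox oy unfolding orbit_def by auto
  define C where "C = (\<lambda>(s, t). frac (s - t)) ` (range x \<times> range y)"
  have "finite C" "C \<noteq> {}"
    using assms(3,4) periodic_finite_range unfolding C_def periodic_orbit_def by auto
  then have "Min C \<in> C" and le: "\<And>c. c \<in> C \<Longrightarrow> Min C \<le> c" by auto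
  then obtain n m where nm: "Min C = frac (x n - y m)" unfolding C_def by auto
  have min: "frac (x n - y m) \<le> frac (x i - y j)" for i j
  proof -
    have "frac (x i - y j) \<in> C" unfolding C_def by force
    then show ?thesis using le nm by metis
  qed
  \<comment> \<open>All differences thus lie strictly between -1 and 1 and are nonzero, so
    \<open>frac\<close> either fixes them or adds 1.\<close>
  have ne: "x i - y j \<noteq> 1" "x i - y j \<noteq> -1" "x i \<noteq> y j" for i j
    using disj[of i j] by auto
  have pos: "frac (x i - y j) = x i - y j" if "y j < x i" for i j
    using that ne[of i j] bnd[of i] bnd[of j] by (auto simp: frac_eq)
  have "x n < y m"
  proof (rule ccontr)
    assume "\<not> x n < y m"
    then have gt: "y m < x n" using ne(3)[of n m] by auto
    \<comment> \<open>Without a wrap, one step shrinks the circular gap by the factor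
      \<open>a\<close>, against minimality.\<close>
    obtain d :: int where "x (Suc n) - y (Suc m) = a * (x n - y m) + of_int d"
      using f_pm_step_diff[OF ox oy] .
    then have "frac (x (Suc n) - y (Suc m)) = frac (a * (x n - y m))"
      by (simp add: frac_def)
    moreover have lt: "a * (x n - y m) < x n - y m" using gt assms(2) by simp
    moreover have "0 \<le> a * (x n - y m)" using gt assms(1) by simp
    then have "frac (a * (x n - y m)) = a * (x n - y m)"
      using lt bnd(1)[of n] bnd(2)[of m] unfolding frac_eq atLeastAtMost_iff by linarith
    ultimately show False using min[of "Suc n" "Suc m"] pos[OF gt] by linarith
  qed
  moreover have "frac (x n - y m) = 1 + x n - y m"
  proof -
    have "frac (x n - y m) = frac (1 + x n - y m)"
      by (metis add_diff_eq add.commute frac_1_eq)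
    also have "\<dots> = 1 + x n - y m"
      using \<open>x n < y m\<close> bnd[of n] bnd[of m] ne(2)[of n m] unfolding frac_eq by auto
    finally show ?thesis .
  qed
  ultimately show thesis using that[of n m] min pos by metis
qed

theorem corollary3p4:
  fixes a b :: real and x y :: "nat \<Rightarrow> real"
  assumes "0 < a" and "a < 1" and "0 \<le> b" and "b < 1"
    and "periodic_orbit a b x" and "periodic_orbit a b y"
  shows "range x = range y"
proof (rule ccontr)
  assume neq: "range x \<noteq> range y"
  have disj: "x n - y m \<notin> \<int>" for n m
  proof
    assume int: "x n - y m \<in> \<int>"
    then have "y m - x n \<in> \<int>" by (metis Ints_minus minus_diff_eq)
    then show False
      using int neq periodic_orbit_range_subset[OF assms(1,2)] assms(5,6)
      by (metis subset_antisym)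
  qed
  then have disj': "y m - x n \<notin> \<int>" for n m by (metis Ints_minus minus_diff_eq)
  \<comment> \<open>Points at distance 1 are congruent, so the forward lemma, applied to
    \<open>z\<close> and itself at offset 0, makes them equal.\<close>
  have no_unit: False if "periodic_orbit a b z" "z j \<ge> 1 + z i" for z i j
  proof -
    have "z i \<in> {0..1}" "z j \<in> {0..1}"
      using that(1) unfolding periodic_orbit_def orbit_def by auto
    then have "z j - z i = 1" using that(2) by auto
    then show False
      using periodic_orbit_forward_eq[OF assms(1,2) that(1,1), of j i 0] by auto
  qed
  obtain n m where nm: "\<And>i j. y j < x i \<Longrightarrow> 1 + x n - y m \<le> x i - y j"
    using minimal_circular_gap_wraps[OF assms(1,2,5,6) disj] by metis
  obtain m' n' where mn: "\<And>i j. x j < y i \<Longrightarrow> 1 + y m' - x n' \<le> y i - x j"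
    using minimal_circular_gap_wraps[OF assms(1,2,6,5) disj'] by metis
  \<comment> \<open>Comparing the lower end \<open>x n'\<close> of the second gap bound with
    \<open>y m\<close> from the first makes one endpoint cancel: either
    \<open>x n' \<ge> 1 + x n\<close> or \<open>y m \<ge> 1 + y m'\<close>.\<close>
  have "x n' \<noteq> y m" using disj[of n' m] by auto
  then consider "y m < x n'" | "x n' < y m" by linarith
  then show False
  proof cases
    case 1
    then show False using nm[OF 1] no_unit[OF assms(5), of n n'] by linarith
  next
    case 2
    then show False using mn[OF 2] no_unit[OF assms(6), of m' m] by linarith
  qed
qed

end
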